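(* There exists an absolute constant $C$ such that the following holds for any monotone Boolean function $f\colon\{0,1\}^n\to\{0,1\}$ and any $M>0$ such that $f$ is $M$-global in some interval $[p,q]$: if $q\le p_c$ and $\mu_p(f)\ge e^{-M/C}$, then \[\mu_q(f)\ge\mu_p(f)^{(p/q)^{1/C}}.\] In particular, $q\le M^Cp$.
   Context: $\mu_x$ is the $x$-biased product measure on $\{0,1\}^n$, $\mu_x(f)=\mathbb{E}_{\mu_x}[f]$. $f$ is monotone if $f(x)\le f(y)$ whenever $x_i\le y_i$ for all $i$. $p_c=\inf\{x:\mu_x(f)\ge1/2\}$ is the critical probability. For $J\subseteq[n]$, $f_{J\to1}$ is the restriction setting coordinates in $J$ to $1$. $f$ is $M$-global in an interval $I$ if for every $J\subseteq[n]$ with $|J|\le M$ and every $x\in I$, $\mu_x(f_{J\to1})\le\mu_x(f)^{0.01}$. *)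

theory Defs
  imports "HOL-Probability.Product_PMF"
begin

text \<open>
  A point of \<open>{0,1}\<^sup>S\<close> is a predicate that is \<open>False\<close> outside the finite index set \<open>S\<close>
  (the default value used by \<open>Pi_pmf\<close> below), so the pointwise order on predicates restricts
  to the coordinatewise order of the cube. The coordinate set of \<open>{0,1}\<^sup>n\<close> is \<open>{1..n}\<close>.
\<close>

definition cube :: "nat set \<Rightarrow> (nat \<Rightarrow> bool) set" where
  "cube S = PiE_dflt S False (\<lambda>_. UNIV)"

definition biased :: "nat set \<Rightarrow> real \<Rightarrow> (nat \<Rightarrow> bool) pmf" where
  "biased S x = Pi_pmf S False (\<lambda>_. bernoulli_pmf x)"

definition mu :: "nat set \<Rightarrow> real \<Rightarrow> ((nat \<Rightarrow> bool) \<Rightarrow> bool) \<Rightarrow> real" where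
  "mu S x f = measure_pmf.expectation (biased S x) (\<lambda>w. of_bool (f w))"

definition crit_prob :: "nat \<Rightarrow> ((nat \<Rightarrow> bool) \<Rightarrow> bool) \<Rightarrow> real" where
  "crit_prob n f = Inf {x \<in> {0..1}. mu {1..n} x f \<ge> 1/2}"

text \<open>For \<open>f\<close> on \<open>{0,1}\<^sup>S\<close> and \<open>J \<subseteq> S\<close>, this is regarded as a function on the cube over \<open>S - J\<close>.\<close>

definition restrict_one :: "nat set \<Rightarrow> ((nat \<Rightarrow> bool) \<Rightarrow> bool) \<Rightarrow> (nat \<Rightarrow> bool) \<Rightarrow> bool" where
  "restrict_one J f = (\<lambda>w. f (override_on w (\<lambda>_. True) J))"

definition global_in :: "nat \<Rightarrow> real \<Rightarrow> real set \<Rightarrow> ((nat \<Rightarrow> bool) \<Rightarrow> bool) \<Rightarrow> bool" where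
  "global_in n M I f \<longleftrightarrow>
     (\<forall>J x. J \<subseteq> {1..n} \<and> real (card J) \<le> M \<and> x \<in> I \<longrightarrow>
        mu ({1..n} - J) x (restrict_one J f) \<le> mu {1..n} x f powr 0.01)"

end

theory Submission
  imports Defs
begin

text \<open>
  Write \<open>\<mu> = mu {1..n} x f\<close> and let \<open>T\<close> be the noise operator with \<open>\<rho> = 1/3\<close>. By Russo's formula
  \<open>x (1 - x) \<mu>'\<close> is the Fourier energy \<open>E\<close> of \<open>f\<close>, and convexity gives \<open>\<langle>f, T f\<rangle> \<ge> \<mu> \<rho> powr (E / \<mu>)\<close>.
  Conversely, if \<open>f\<close> is monotone and \<open>mu (f\<^sub>J) \<le> \<beta> 2 ^ card J\<close> for all \<open>J\<close>, then \<open>\<parallel>T f\<parallel>\<^sub>4 ^ 4 \<le> \<beta> \<mu>\<close> by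
  induction on the dimension. Globalness provides this with \<open>\<beta> = \<mu> powr 0.01\<close>, also when \<open>card J > M\<close>
  because \<open>\<mu> \<ge> exp (- M / C)\<close>. By Hoelder's inequality \<open>\<langle>f, T f\<rangle> \<le> \<mu> powr 1.0025\<close>, hence
  \<open>E \<ge> \<mu> ln (1 / \<mu>) / 800\<close>, and this differential inequality is integrated from \<open>p\<close> to \<open>q\<close>.
\<close>

section \<open>Expectation, noise and energy on bit lists\<close>

text \<open>Points are bit lists, so that recursion and induction can peel off one coordinate at a
  time.\<close>

fun expect :: "nat \<Rightarrow> real \<Rightarrow> (bool list \<Rightarrow> real) \<Rightarrow> real" where
  "expect 0 x f = f []"
| "expect (Suc n) x f = x * expect n x (\<lambda>l. f (True # l)) + (1 - x) * expect n x (\<lambda>l. f (False # l))"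

text \<open>The noise operator: independently, each bit is kept with probability \<rho> and
  otherwise redrawn with bias \<open>x\<close>.\<close>

fun noise :: "real \<Rightarrow> real \<Rightarrow> (bool list \<Rightarrow> real) \<Rightarrow> bool list \<Rightarrow> real" where
  "noise x \<rho> f [] = f []"
| "noise x \<rho> f (b # l) =
    (1 - \<rho>) * (x * noise x \<rho> (\<lambda>v. f (True # v)) l + (1 - x) * noise x \<rho> (\<lambda>v. f (False # v)) l)
      + \<rho> * noise x \<rho> (\<lambda>v. f (b # v)) l"

text \<open>For \<open>0 < x < 1\<close> this is the total influence: the sum over the coordinates
  of the mean conditional variance, or equivalently the squared Fourier coefficients summed with
  their degrees as weights.\<close>

fun energy :: "nat \<Rightarrow> real \<Rightarrow> (bool list \<Rightarrow> real) \<Rightarrow> real" where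
  "energy 0 x f = 0"
| "energy (Suc n) x f = x * energy n x (\<lambda>l. f (True # l)) + (1 - x) * energy n x (\<lambda>l. f (False # l))
      + x * (1 - x) * expect n x (\<lambda>l. (f (True # l) - f (False # l))\<^sup>2)"

lemma expect_add: "expect n x (\<lambda>l. f l + g l) = expect n x f + expect n x g"
  by (induction n arbitrary: f g) (simp_all add: algebra_simps)

lemma expect_cmult: "expect n x (\<lambda>l. c * f l) = c * expect n x f"
  by (induction n arbitrary: f) (simp_all add: algebra_simps)

lemma expect_diff: "expect n x (\<lambda>l. f l - g l) = expect n x f - expect n x g"
  using expect_add[of n x f "\<lambda>l. (-1) * g l"] expect_cmult[of n x "-1" g] by simp

lemma expect_const: "expect n x (\<lambda>l. c) = c"
  by (induction n) (simp_all add: algebra_simps)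

lemma expect_mono:
  assumes "0 \<le> x" "x \<le> 1" "\<And>l. length l = n \<Longrightarrow> f l \<le> g l"
  shows "expect n x f \<le> expect n x g"
  using assms(3)
proof (induction n arbitrary: f g)
  case (Suc n)
  then have "expect n x (\<lambda>l. f (b # l)) \<le> expect n x (\<lambda>l. g (b # l))" for b
    by simp
  then show ?case
    using assms(1,2) by (auto intro!: add_mono mult_left_mono)
qed simp

lemma expect_cong:
  assumes "\<And>l. length l = n \<Longrightarrow> f l = g l"
  shows "expect n x f = expect n x g"
  using assms
proof (induction n arbitrary: f g)
  case (Suc n)
  have "expect n x (\<lambda>l. f (b # l)) = expect n x (\<lambda>l. g (b # l))" for b
    by (rule Suc.IH) (simp add: Suc.prems)
  then show ?case
    by simp
qed simp

lemma noise_lin: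
  "noise x \<rho> (\<lambda>v. c * f v + d * g v) l = c * noise x \<rho> f l + d * noise x \<rho> g l"
  by (induction l arbitrary: f g) (simp_all add: algebra_simps)

lemma noise_cmult: "noise x \<rho> (\<lambda>v. c * f v) l = c * noise x \<rho> f l"
  using noise_lin[of x \<rho> c f 0 f l] by simp

lemma noise_mono:
  assumes "0 \<le> x" "x \<le> 1" "0 \<le> \<rho>" "\<rho> \<le> 1" "\<And>v. length v = length l \<Longrightarrow> f v \<le> g v"
  shows "noise x \<rho> f l \<le> noise x \<rho> g l"
  using assms(5)
proof (induction l arbitrary: f g)
  case (Cons b l)
  then have "noise x \<rho> (\<lambda>v. f (c # v)) l \<le> noise x \<rho> (\<lambda>v. g (c # v)) l" for c
    by simp
  then show ?case
    using assms(1-4) by (auto intro!: add_mono mult_left_mono)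
qed simp

lemma noise_nonneg:
  assumes "0 \<le> x" "x \<le> 1" "0 \<le> \<rho>" "\<rho> \<le> 1" "\<And>v. length v = length l \<Longrightarrow> 0 \<le> f v"
  shows "0 \<le> noise x \<rho> f l"
  using noise_mono[OF assms(1-4), of l "\<lambda>v. 0" f] noise_cmult[of x \<rho> 0 f l] assms(5) by simp

section \<open>Splitting off the first coordinate\<close>

text \<open>For \<open>0 < x < 1\<close>, \<open>avg\<close> and \<open>dif\<close> give the
  coefficients of \<open>f\<close> in the orthonormal basis 1, (b - x) / sqrt (x (1 - x)) of the
  functions of the first bit b.\<close>

definition avg :: "real \<Rightarrow> (bool list \<Rightarrow> real) \<Rightarrow> bool list \<Rightarrow> real" where
  "avg x f l = x * f (True # l) + (1 - x) * f (False # l)"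

definition dif :: "real \<Rightarrow> (bool list \<Rightarrow> real) \<Rightarrow> bool list \<Rightarrow> real" where
  "dif x f l = sqrt (x * (1 - x)) * (f (True # l) - f (False # l))"

lemma noise_avg:
  "noise x \<rho> (avg x f) l =
    x * noise x \<rho> (\<lambda>v. f (True # v)) l + (1 - x) * noise x \<rho> (\<lambda>v. f (False # v)) l"
  unfolding avg_def[abs_def] by (rule noise_lin)

lemma noise_dif:
  "noise x \<rho> (dif x f) l =
    sqrt (x * (1 - x)) * (noise x \<rho> (\<lambda>v. f (True # v)) l - noise x \<rho> (\<lambda>v. f (False # v)) l)"
  using noise_lin[of x \<rho> "sqrt (x * (1 - x))" "\<lambda>v. f (True # v)" "- sqrt (x * (1 - x))" "\<lambda>v. f (False # v)" l]
  unfolding dif_def[abs_def] by (simp add: algebra_simps)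

lemma sqrt_var_sq:
  assumes "0 \<le> x" "x \<le> 1"
  shows "sqrt (x * (1 - x)) * (sqrt (x * (1 - x)) * z) = x * (1 - x) * z"
  using assms by (simp flip: mult.assoc)

text \<open>Parseval's identity in the first coordinate.\<close>

lemma expect_square_split:
  assumes "0 \<le> x" "x \<le> 1"
  shows "expect (Suc n) x (\<lambda>l. (f l)\<^sup>2) = expect n x (\<lambda>l. (avg x f l)\<^sup>2) + expect n x (\<lambda>l. (dif x f l)\<^sup>2)"
proof -
  have "expect n x (\<lambda>l. (avg x f l)\<^sup>2) + expect n x (\<lambda>l. (dif x f l)\<^sup>2)
      = expect n x (\<lambda>l. x * (f (True # l))\<^sup>2 + (1 - x) * (f (False # l))\<^sup>2)"
    unfolding expect_add[symmetric]
  proof (rule expect_cong)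
    fix l :: "bool list"
    have "(dif x f l)\<^sup>2 = x * (1 - x) * (f (True # l) - f (False # l))\<^sup>2"
      using assms by (simp add: dif_def power_mult_distrib)
    then show "(avg x f l)\<^sup>2 + (dif x f l)\<^sup>2 = x * (f (True # l))\<^sup>2 + (1 - x) * (f (False # l))\<^sup>2"
      unfolding avg_def by algebra
  qed
  then show ?thesis
    by (simp add: expect_add expect_cmult)
qed

text \<open>Noise on the first bit is diagonal in the basis above: it fixes 1 and multiplies the
  other basis function by \<rho>. The remaining bits act on the two coefficients separately.\<close>

lemma expect_noise_split:
  assumes "0 \<le> x" "x \<le> 1"
  shows "expect (Suc n) x (\<lambda>l. f l * noise x \<rho> f l) =
    expect n x (\<lambda>l. avg x f l * noise x \<rho> (avg x f) l) + \<rho> * expect n x (\<lambda>l. dif x f l * noise x \<rho> (dif x f) l)"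
proof -
  define F where "F b l = noise x \<rho> (\<lambda>v. f (b # v)) l" for b l
  have "expect n x (\<lambda>l. avg x f l * noise x \<rho> (avg x f) l) + \<rho> * expect n x (\<lambda>l. dif x f l * noise x \<rho> (dif x f) l)
      = expect n x (\<lambda>l. x * (f (True # l) * noise x \<rho> f (True # l))
          + (1 - x) * (f (False # l) * noise x \<rho> f (False # l)))"
    unfolding expect_add[symmetric] expect_cmult[symmetric]
  proof (rule expect_cong)
    fix l :: "bool list"
    have "dif x f l * noise x \<rho> (dif x f) l
        = sqrt (x * (1 - x)) * (sqrt (x * (1 - x)) * ((f (True # l) - f (False # l)) * (F True l - F False l)))"
      unfolding noise_dif dif_def F_def by (simp only: mult_ac)
    then have "dif x f l * noise x \<rho> (dif x f) l
        = x * (1 - x) * ((f (True # l) - f (False # l)) * (F True l - F False l))"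
      unfolding sqrt_var_sq[OF assms] .
    then show "avg x f l * noise x \<rho> (avg x f) l + \<rho> * (dif x f l * noise x \<rho> (dif x f) l)
        = x * (f (True # l) * noise x \<rho> f (True # l)) + (1 - x) * (f (False # l) * noise x \<rho> f (False # l))"
      unfolding noise_avg noise.simps F_def[symmetric] avg_def by algebra
  qed
  then show ?thesis
    by (simp only: expect_add expect_cmult expect.simps)
qed

section \<open>Energy under the splitting, and noise stability from below\<close>

lemma energy_nonneg:
  assumes "0 \<le> x" "x \<le> 1"
  shows "0 \<le> energy n x f"
proof (induction n arbitrary: f)
  case (Suc n)
  have "0 \<le> expect n x (\<lambda>l. (f (True # l) - f (False # l))\<^sup>2)"
    using expect_mono[OF assms, of n "\<lambda>_. 0"] by (simp add: expect_const)
  then show ?case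
    using Suc assms by simp
qed simp

text \<open>The energy is a combination of squares of linear functionals, and x a^2 + (1 - x) b^2 =
  (x a + (1 - x) b)^2 + x (1 - x) (a - b)^2 applies to each of them.\<close>

lemma energy_avg_dif:
  assumes "0 \<le> x" "x \<le> 1"
  shows "energy n x (\<lambda>l. x * f l + (1 - x) * g l) + energy n x (\<lambda>l. sqrt (x * (1 - x)) * (f l - g l))
    = x * energy n x f + (1 - x) * energy n x g"
proof (induction n arbitrary: f g)
  case (Suc n)
  define s where "s = sqrt (x * (1 - x))"
  have s: "s\<^sup>2 = x * (1 - x)"
    using assms by (simp add: s_def)
  have IH: "energy n x (\<lambda>l. x * f (b # l) + (1 - x) * g (b # l)) + energy n x (\<lambda>l. s * (f (b # l) - g (b # l)))
    = x * energy n x (\<lambda>l. f (b # l)) + (1 - x) * energy n x (\<lambda>l. g (b # l))" for b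
    unfolding s_def by (rule Suc.IH)
  have "expect n x (\<lambda>l. (x * f (True # l) + (1 - x) * g (True # l) - (x * f (False # l) + (1 - x) * g (False # l)))\<^sup>2)
      + expect n x (\<lambda>l. (s * (f (True # l) - g (True # l)) - s * (f (False # l) - g (False # l)))\<^sup>2)
      = expect n x (\<lambda>l. x * (f (True # l) - f (False # l))\<^sup>2 + (1 - x) * (g (True # l) - g (False # l))\<^sup>2)"
    unfolding expect_add[symmetric]
  proof (rule expect_cong)
    fix l :: "bool list"
    show "(x * f (True # l) + (1 - x) * g (True # l) - (x * f (False # l) + (1 - x) * g (False # l)))\<^sup>2
      + (s * (f (True # l) - g (True # l)) - s * (f (False # l) - g (False # l)))\<^sup>2
      = x * (f (True # l) - f (False # l))\<^sup>2 + (1 - x) * (g (True # l) - g (False # l))\<^sup>2"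
      using s by algebra
  qed
  then have N: "expect n x (\<lambda>l. (x * f (True # l) + (1 - x) * g (True # l) - (x * f (False # l) + (1 - x) * g (False # l)))\<^sup>2)
      + expect n x (\<lambda>l. (s * (f (True # l) - g (True # l)) - s * (f (False # l) - g (False # l)))\<^sup>2)
      = x * expect n x (\<lambda>l. (f (True # l) - f (False # l))\<^sup>2) + (1 - x) * expect n x (\<lambda>l. (g (True # l) - g (False # l))\<^sup>2)"
    by (simp add: expect_add expect_cmult)
  show ?case
    unfolding energy.simps s_def[symmetric] using IH[of True] IH[of False] N by algebra
qed simp

text \<open>A Fourier character that involves the first coordinate has one degree more than its part
  on the other coordinates; the last term accounts for it.\<close>

lemma energy_split:
  assumes "0 \<le> x" "x \<le> 1"
  shows "energy (Suc n) x f = energy n x (avg x f) + energy n x (dif x f) + expect n x (\<lambda>l. (dif x f l)\<^sup>2)"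
proof -
  have "(\<lambda>l. (dif x f l)\<^sup>2) = (\<lambda>l. x * (1 - x) * (f (True # l) - f (False # l))\<^sup>2)"
    using assms by (simp add: dif_def power_mult_distrib)
  then show ?thesis
    using energy_avg_dif[OF assms, of n "\<lambda>l. f (True # l)" "\<lambda>l. f (False # l)"]
    by (simp add: expect_cmult avg_def[abs_def] dif_def[abs_def])
qed

text \<open>
  The affine minorant at \<open>K\<close> of \<open>exp (- s * k)\<close>, averaged over the degrees \<open>k\<close> of the Fourier spectrum;
  unlike Jensen's inequality itself, it is stable under the induction.
\<close>

lemma noise_stability_ge:
  assumes "0 \<le> x" "x \<le> 1" "\<rho> = exp (- s)"
  shows "exp (- s * K) * ((1 + s * K) * expect n x (\<lambda>l. (f l)\<^sup>2) - s * energy n x f)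
    \<le> expect n x (\<lambda>l. f l * noise x \<rho> f l)"
proof (induction n arbitrary: f K)
  case 0
  have "exp (- s * K) * (1 + s * K) \<le> exp (- s * K) * exp (s * K)"
    by (intro mult_left_mono exp_ge_add_one_self) simp
  also have "\<dots> = 1"
    by (simp flip: exp_add)
  finally show ?case
    using mult_right_mono[of "exp (- s * K) * (1 + s * K)" 1 "(f [])\<^sup>2"]
    by (simp add: power2_eq_square mult_ac)
next
  case (Suc n)
  define a where "a = expect n x (\<lambda>l. (avg x f l)\<^sup>2)"
  define b where "b = expect n x (\<lambda>l. (dif x f l)\<^sup>2)"
  \<comment> \<open>Degrees in the \<open>dif\<close> part are one lower than in \<open>f\<close>,
    so the induction hypothesis is used there at \<open>K - 1\<close>. The factor
    \<open>exp (- s)\<close> released by the shift is the \<rho> in front of that part.\<close>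
  have e: "exp (- s * K) = exp (- s) * exp (- s * (K - 1))"
    by (simp add: algebra_simps flip: exp_add)
  have "exp (- s * K) * ((1 + s * K) * (a + b) - s * (energy n x (avg x f) + energy n x (dif x f) + b))
      = exp (- s * K) * ((1 + s * K) * a - s * energy n x (avg x f))
      + exp (- s * K) * ((1 + s * (K - 1)) * b - s * energy n x (dif x f))"
    by algebra
  also have "\<dots> = exp (- s * K) * ((1 + s * K) * a - s * energy n x (avg x f))
      + \<rho> * (exp (- s * (K - 1)) * ((1 + s * (K - 1)) * b - s * energy n x (dif x f)))"
    unfolding e assms(3) by (simp only: mult_ac)
  also have "\<dots> \<le> expect n x (\<lambda>l. avg x f l * noise x \<rho> (avg x f) l)
      + \<rho> * expect n x (\<lambda>l. dif x f l * noise x \<rho> (dif x f) l)"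
    unfolding a_def b_def using Suc.IH by (intro add_mono mult_left_mono) (simp_all add: assms(3))
  finally show ?case
    unfolding expect_noise_split[OF assms(1,2)] expect_square_split[OF assms(1,2)] energy_split[OF assms(1,2)]
      a_def b_def .
qed

section \<open>Hypercontractivity for global monotone functions\<close>

text \<open>The one-coordinate step, with \<rho> = 1/3. \<open>V\<close> is charged partly to the
  mean square of \<open>F\<close> and partly to the square of \<open>F1\<close>. The latter belongs
  to the restriction to 1, whose bound is twice as large, so the weights are balanced: 1/2 + 2 * 1/4
  = 1.\<close>

lemma two_point_hypercontractive:
  fixes x F1 F0 G1 G0 :: real
  assumes x: "0 \<le> x" "x \<le> 1" and F: "0 \<le> F0" "F0 \<le> F1"
  defines "A \<equiv> x * F1 + (1 - x) * F0" and "C \<equiv> x * G1 + (1 - x) * G0"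
    and "V \<equiv> x * (1 - x) * (G1 - G0)\<^sup>2"
  shows "x * ((2/3 * A + 1/3 * F1)\<^sup>2 * (2/3 * C + 1/3 * G1)\<^sup>2)
      + (1 - x) * ((2/3 * A + 1/3 * F0)\<^sup>2 * (2/3 * C + 1/3 * G0)\<^sup>2)
    \<le> (x * F1\<^sup>2 + (1 - x) * F0\<^sup>2) * (C\<^sup>2 + V / 2) + F1\<^sup>2 * V / 4"
proof -
  define u v t where "u = F1 - F0" and "v = G1 - G0" and "t = 1 - 2 * x"
  have t: "\<bar>t\<bar> \<le> 1"
    using x by (auto simp: t_def)
  \<comment> \<open>Monotonicity enters here: the discrete derivative of \<open>F\<close> is
    controlled by the value at 1 alone.\<close>
  have u: "u\<^sup>2 \<le> F1\<^sup>2"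
    using F by (intro power_mono) (auto simp: u_def)
  have s: "0 \<le> x * (1 - x)"
    using x by simp
  have e1: "4 * (A * C * u * v) \<le> 2 * (A\<^sup>2 * v\<^sup>2 + C\<^sup>2 * u\<^sup>2)"
    using zero_le_power2[of "A * v - C * u"] by (simp add: power2_eq_square algebra_simps)
  have young: "2 * t * (y * z) \<le> y\<^sup>2 + z\<^sup>2" for y z :: real
  proof -
    have "2 * t * (y * z) \<le> \<bar>t\<bar> * (2 * \<bar>y\<bar> * \<bar>z\<bar>)"
      using abs_ge_self[of "2 * t * (y * z)"] by (simp add: abs_mult mult_ac)
    also have "\<dots> \<le> 1 * (2 * \<bar>y\<bar> * \<bar>z\<bar>)"
      using t by (intro mult_right_mono) simp_all
    also have "\<dots> \<le> y\<^sup>2 + z\<^sup>2"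
      using sum_squares_bound[of "\<bar>y\<bar>" "\<bar>z\<bar>"] by simp
    finally show ?thesis .
  qed
  have e2: "2 * t * (A * v * (u * v)) \<le> A\<^sup>2 * v\<^sup>2 + F1\<^sup>2 * v\<^sup>2"
    using young[of "A * v" "u * v"] mult_right_mono[OF u, of "v\<^sup>2"] by (simp add: power_mult_distrib)
  have e3: "2 * t * (C * u * (u * v)) \<le> C\<^sup>2 * u\<^sup>2 + F1\<^sup>2 * v\<^sup>2"
    using young[of "C * u" "u * v"] mult_right_mono[OF u, of "v\<^sup>2"] by (simp add: power_mult_distrib)
  have "(1 - 3 * (x * (1 - x))) * (u\<^sup>2 * v\<^sup>2) \<le> 1 * (F1\<^sup>2 * v\<^sup>2)"
    using u s x by (intro mult_mono mult_right_mono) auto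
  then have e4: "(1 - 3 * (x * (1 - x))) * (u\<^sup>2 * v\<^sup>2) \<le> F1\<^sup>2 * v\<^sup>2"
    by simp
  have nonneg: "0 \<le> A\<^sup>2 * v\<^sup>2" "0 \<le> C\<^sup>2 * u\<^sup>2" "0 \<le> F1\<^sup>2 * v\<^sup>2" "0 \<le> u\<^sup>2 * v\<^sup>2"
    by simp_all
  \<comment> \<open>The left-hand side equals
    \<open>A\<^sup>2 * C\<^sup>2 + x * (1 - x) * W\<close>. The factors \<open>t\<close> and
    \<open>1 - 3 * (x * (1 - x))\<close> come from the third and fourth central moments of a bit,
    and 1/9, 1/27, 1/81 are powers of \<rho>.\<close>
  define W where "W = 1/9 * (A\<^sup>2 * v\<^sup>2 + C\<^sup>2 * u\<^sup>2 + 4 * (A * C * u * v))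
      + 1/27 * (2 * t * (A * v * (u * v)) + 2 * t * (C * u * (u * v)))
      + 1/81 * ((1 - 3 * (x * (1 - x))) * (u\<^sup>2 * v\<^sup>2))"
  have "W \<le> C\<^sup>2 * u\<^sup>2 + A\<^sup>2 * v\<^sup>2 / 2 + F1\<^sup>2 * v\<^sup>2 / 4"
  proof -
    \<comment> \<open>After substitution the coefficients of \<open>a\<close>, \<open>b\<close>,
      \<open>h\<close> are 10/27, 10/27 and 7/81, below the allowed 1/2, 1 and 1/4.\<close>
    have "1/9 * (a + b + c) + 1/27 * (d + e) + 1/81 * g \<le> b + a / 2 + h / 4"
      if "c \<le> 2 * (a + b)" "d \<le> a + h" "e \<le> b + h" "g \<le> h" "0 \<le> a" "0 \<le> b" "0 \<le> h"
      for a b c d e g h :: real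
      using that by argo
    from this[OF e1 e2 e3 e4 nonneg(1-3)] show ?thesis
      unfolding W_def .
  qed
  then have "x * (1 - x) * W \<le> x * (1 - x) * (C\<^sup>2 * u\<^sup>2 + A\<^sup>2 * v\<^sup>2 / 2 + F1\<^sup>2 * v\<^sup>2 / 4)"
    using s by (rule mult_left_mono)
  moreover have "x * ((2/3 * A + 1/3 * F1)\<^sup>2 * (2/3 * C + 1/3 * G1)\<^sup>2)
      + (1 - x) * ((2/3 * A + 1/3 * F0)\<^sup>2 * (2/3 * C + 1/3 * G0)\<^sup>2) = A\<^sup>2 * C\<^sup>2 + x * (1 - x) * W"
  proof -
    have h: "F1 = A + (1 - x) * u" "F0 = A - x * u" "G1 = C + (1 - x) * v" "G0 = C - x * v"
      unfolding A_def C_def u_def v_def by algebra+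
    show ?thesis
      unfolding h W_def t_def by (simp add: power2_eq_square field_simps)
  qed
  moreover have "(x * F1\<^sup>2 + (1 - x) * F0\<^sup>2) * (C\<^sup>2 + V / 2) + F1\<^sup>2 * V / 4
      = A\<^sup>2 * C\<^sup>2 + x * (1 - x) * (C\<^sup>2 * u\<^sup>2 + A\<^sup>2 * v\<^sup>2 / 2 + F1\<^sup>2 * v\<^sup>2 / 4)
        + (x * (1 - x))\<^sup>2 * (u\<^sup>2 * v\<^sup>2) / 2"
  proof -
    have "x * F1\<^sup>2 + (1 - x) * F0\<^sup>2 = A\<^sup>2 + x * (1 - x) * u\<^sup>2"
      unfolding A_def u_def by algebra
    moreover have "(a + s * w) * (d + s * z / 2) + h * (s * z) / 4
        = a * d + s * (d * w + a * z / 2 + h * z / 4) + s\<^sup>2 * (w * z) / 2" for a s w d z h :: real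
      by (simp add: power2_eq_square field_simps)
    ultimately show ?thesis
      unfolding V_def v_def[symmetric] by presburger
  qed
  ultimately show ?thesis
    using nonneg(4) by (simp add: add_increasing2)
qed


text \<open>
  The induction replaces each \<open>f\<close> by its two restrictions in the first coordinate, weighted by
  their probabilities; this is why a family \<open>fs\<close> is needed. The list \<open>js\<close> encodes the set of
  coordinates restricted to 1.
\<close>

lemma global_hypercontractive:
  assumes x: "0 \<le> x" "x \<le> 1"
    and "\<And>f l. f \<in> set fs \<Longrightarrow> 0 \<le> f l"
    and "\<And>f l m. f \<in> set fs \<Longrightarrow> list_all2 (\<longrightarrow>) l m \<Longrightarrow> f l \<le> f m"
    and "\<And>js. length js = n \<Longrightarrow>
      (\<Sum>f\<leftarrow>fs. expect n x (\<lambda>l. (f (map2 (\<or>) js l))\<^sup>2)) \<le> \<beta> * 2 ^ count_list js True"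
  shows "(\<Sum>f\<leftarrow>fs. expect n x (\<lambda>l. (noise x (1/3) f l)\<^sup>2 * (noise x (1/3) g l)\<^sup>2))
    \<le> \<beta> * expect n x (\<lambda>l. (g l)\<^sup>2)"
  using assms(3-5)
proof (induction n arbitrary: fs \<beta> g)
  case 0
  have "(\<Sum>f\<leftarrow>fs. (f [])\<^sup>2) \<le> \<beta>"
    using "0.prems"(3)[of "[]"] by simp
  then show ?case
    by (simp add: sum_list_mult_const mult_right_mono)
next
  case (Suc n)
  define T where "T f = noise x (1/3) f" for f
  define F where "F b f = (\<lambda>l. f (b # l))" for b and f :: "bool list \<Rightarrow> real"
  define P where "P b h = (\<Sum>f\<leftarrow>fs. expect n x (\<lambda>l. (T (F b f) l)\<^sup>2 * (T h l)\<^sup>2))" for b h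
  \<comment> \<open>This is needed for \<open>h\<close> both the \<open>avg\<close> and the
    \<open>dif\<close> of \<open>g\<close>, which is why \<open>g\<close> is independent of the
    family and arbitrary in the induction.\<close>
  have P_avg: "x * P True h + (1 - x) * P False h \<le> \<beta> * expect n x (\<lambda>l. (h l)\<^sup>2)" for h
  proof -
    \<comment> \<open>The functions enter through their squares, so square roots of the
      probabilities are the right weights.\<close>
    define fs' where "fs' = map (\<lambda>f l. sqrt x * F True f l) fs @ map (\<lambda>f l. sqrt (1 - x) * F False f l) fs"
    have scale: "(sqrt c * y)\<^sup>2 * z = c * (y\<^sup>2 * z)" if "0 \<le> c" for c y z :: real
      using that by (simp add: power_mult_distrib)
    have scale': "(sqrt c * y)\<^sup>2 = c * y\<^sup>2" if "0 \<le> c" for c y :: real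
      using that by (simp add: power_mult_distrib)
    have "(\<Sum>f\<leftarrow>fs'. expect n x (\<lambda>l. (noise x (1/3) f l)\<^sup>2 * (noise x (1/3) h l)\<^sup>2))
      \<le> \<beta> * expect n x (\<lambda>l. (h l)\<^sup>2)"
    proof (rule Suc.IH)
      show "0 \<le> f l" if "f \<in> set fs'" for f l
        using that Suc.prems(1) x by (auto simp: fs'_def F_def)
      show "f l \<le> f m" if "f \<in> set fs'" "list_all2 (\<longrightarrow>) l m" for f l m
        using that Suc.prems(2) x by (auto simp: fs'_def F_def intro!: mult_left_mono)
      show "(\<Sum>f\<leftarrow>fs'. expect n x (\<lambda>l. (f (map2 (\<or>) js l))\<^sup>2)) \<le> \<beta> * 2 ^ count_list js True"
        if "length js = n" for js
        using Suc.prems(3)[of "False # js"] that x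
        by (simp add: fs'_def F_def comp_def scale' expect_cmult sum_list_addf sum_list_const_mult)
    qed
    then show ?thesis
      using x by (simp add: fs'_def comp_def noise_cmult scale expect_cmult sum_list_const_mult P_def T_def)
  qed
  have P_one: "P True h \<le> (2 * \<beta>) * expect n x (\<lambda>l. (h l)\<^sup>2)" for h
  proof -
    have "(\<Sum>f\<leftarrow>map (F True) fs. expect n x (\<lambda>l. (noise x (1/3) f l)\<^sup>2 * (noise x (1/3) h l)\<^sup>2))
      \<le> (2 * \<beta>) * expect n x (\<lambda>l. (h l)\<^sup>2)"
    proof (rule Suc.IH)
      show "0 \<le> f l" if "f \<in> set (map (F True) fs)" for f l
        using that Suc.prems(1) by (auto simp: F_def)
      show "f l \<le> f m" if "f \<in> set (map (F True) fs)" "list_all2 (\<longrightarrow>) l m" for f l m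
        using that Suc.prems(2) by (auto simp: F_def)
      show "(\<Sum>f\<leftarrow>map (F True) fs. expect n x (\<lambda>l. (f (map2 (\<or>) js l))\<^sup>2)) \<le> 2 * \<beta> * 2 ^ count_list js True"
        if "length js = n" for js
        \<comment> \<open>With \<open>True\<close> at the head of the code both restrictions
          coincide and their weights add up to 1; the extra \<open>True\<close> in the count is the
          factor 2 on \<beta>.\<close>
        using Suc.prems(3)[of "True # js"] that
        by (simp add: F_def comp_def mult_ac flip: distrib_right)
    qed
    then show ?thesis
      by (simp add: comp_def P_def T_def)
  qed
  have step: "expect (Suc n) x (\<lambda>l. (T f l)\<^sup>2 * (T g l)\<^sup>2)
    \<le> x * expect n x (\<lambda>l. (T (F True f) l)\<^sup>2 * (T (avg x g) l)\<^sup>2)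
      + (1 - x) * expect n x (\<lambda>l. (T (F False f) l)\<^sup>2 * (T (avg x g) l)\<^sup>2)
      + 1/2 * (x * expect n x (\<lambda>l. (T (F True f) l)\<^sup>2 * (T (dif x g) l)\<^sup>2)
      + (1 - x) * expect n x (\<lambda>l. (T (F False f) l)\<^sup>2 * (T (dif x g) l)\<^sup>2))
      + 1/4 * expect n x (\<lambda>l. (T (F True f) l)\<^sup>2 * (T (dif x g) l)\<^sup>2)" if f: "f \<in> set fs" for f
    unfolding expect.simps expect_cmult[symmetric] expect_add[symmetric]
  proof (rule expect_mono[OF x])
    fix l :: "bool list"
    \<comment> \<open>Noise preserves the order of the two restrictions, as the two-point inequality
      requires.\<close>
    have le: "T (F False f) l \<le> T (F True f) l"
      unfolding T_def
    proof (rule noise_mono)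
      show "F False f v \<le> F True f v" for v
        unfolding F_def by (rule Suc.prems(2)[OF f]) (simp add: list.rel_refl)
    qed (use x in auto)
    have nonneg: "0 \<le> T (F False f) l"
      unfolding T_def by (rule noise_nonneg) (use x Suc.prems(1)[OF f] in \<open>auto simp: F_def\<close>)
    have V: "(T (dif x g) l)\<^sup>2 = x * (1 - x) * (T (F True g) l - T (F False g) l)\<^sup>2"
      using x by (simp add: T_def noise_dif power_mult_distrib F_def)
    have T_Cons: "T h (b # l) = 2/3 * (x * T (F True h) l + (1 - x) * T (F False h) l) + 1/3 * T (F b h) l" for h b
      by (simp add: T_def F_def)
    have T_avg: "T (avg x g) l = x * T (F True g) l + (1 - x) * T (F False g) l"
      by (simp add: T_def F_def noise_avg)
    have distrib: "(x * a + (1 - x) * b) * (d + v / 2) + a * v / 4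
        = x * (a * d) + (1 - x) * (b * d) + 1/2 * (x * (a * v) + (1 - x) * (b * v)) + 1/4 * (a * v)" for a b d v
      by (simp add: field_simps)
    show "x * ((T f (True # l))\<^sup>2 * (T g (True # l))\<^sup>2) + (1 - x) * ((T f (False # l))\<^sup>2 * (T g (False # l))\<^sup>2)
      \<le> x * ((T (F True f) l)\<^sup>2 * (T (avg x g) l)\<^sup>2) + (1 - x) * ((T (F False f) l)\<^sup>2 * (T (avg x g) l)\<^sup>2)
      + 1/2 * (x * ((T (F True f) l)\<^sup>2 * (T (dif x g) l)\<^sup>2) + (1 - x) * ((T (F False f) l)\<^sup>2 * (T (dif x g) l)\<^sup>2))
      + 1/4 * ((T (F True f) l)\<^sup>2 * (T (dif x g) l)\<^sup>2)"
      using two_point_hypercontractive[OF x nonneg le, of "T (F True g) l" "T (F False g) l"]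
      unfolding distrib V[symmetric] T_avg[symmetric] T_Cons .
  qed
  have "(\<Sum>f\<leftarrow>fs. expect (Suc n) x (\<lambda>l. (T f l)\<^sup>2 * (T g l)\<^sup>2))
    \<le> x * P True (avg x g) + (1 - x) * P False (avg x g)
      + 1/2 * (x * P True (dif x g) + (1 - x) * P False (dif x g)) + 1/4 * P True (dif x g)"
    unfolding P_def sum_list_const_mult[symmetric] sum_list_addf[symmetric]
    by (rule sum_list_mono) (rule step)
  also have "\<dots> \<le> \<beta> * expect n x (\<lambda>l. (avg x g l)\<^sup>2) + \<beta> * expect n x (\<lambda>l. (dif x g l)\<^sup>2)"
  proof -
    have "a + 1/2 * b + 1/4 * c \<le> d + e" if "a \<le> d" "b \<le> e" "c \<le> 2 * e" for a b c d e :: real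
      using that by simp
    from this[OF P_avg P_avg P_one[unfolded mult.assoc]] show ?thesis .
  qed
  finally show ?case
    unfolding T_def expect_square_split[OF x] by (simp only: distrib_left)
qed

section \<open>Energy of a global function from below\<close>

text \<open>Noise stability is at least \<open>exp (- ln 3 * (E / m)) * m\<close> and at most
  \<open>c * m\<close>. Taking logarithms, with \<open>ln 3 \<le> 2\<close>, turns the exponent
  0.0025 into 1/800.\<close>

lemma energy_ge_of_global:
  assumes x: "0 \<le> x" "x \<le> 1"
    and bool: "\<And>l. f l = 0 \<or> f l = 1"
    and mono: "\<And>l m. list_all2 (\<longrightarrow>) l m \<Longrightarrow> f l \<le> f m"
    and pos: "0 < expect n x f"
    and global: "\<And>js. length js = n \<Longrightarrow>
      expect n x (\<lambda>l. f (map2 (\<or>) js l)) \<le> expect n x f powr 0.01 * 2 ^ count_list js True"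
  shows "- (expect n x f * ln (expect n x f)) / 800 \<le> energy n x f"
proof -
  define m where "m = expect n x f"
  define c where "c = m powr 0.0025"
  define E where "E = energy n x f"
  have m: "0 < m" "m \<le> 1"
  proof -
    show "0 < m" using pos by (simp add: m_def)
    have "expect n x f \<le> expect n x (\<lambda>_. 1)"
      using bool by (intro expect_mono[OF x]) (metis order_refl zero_le_one)
    then show "m \<le> 1" by (simp add: m_def expect_const)
  qed
  have c: "0 < c" "c ^ 4 = m powr 0.01"
    using m by (auto simp: c_def powr_power)
  have sq: "(f l)\<^sup>2 = f l" for l
    using bool[of l] by auto
  have nonneg: "0 \<le> f l" for l
    using bool[of l] by auto
  have T4: "expect n x (\<lambda>l. (noise x (1/3) f l) ^ 4) \<le> m powr 0.01 * m"
  proof -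
    have "(\<Sum>f\<leftarrow>[f]. expect n x (\<lambda>l. (noise x (1/3) f l)\<^sup>2 * (noise x (1/3) f l)\<^sup>2))
      \<le> m powr 0.01 * expect n x (\<lambda>l. (f l)\<^sup>2)"
      using global_hypercontractive[OF x, of "[f]" n "m powr 0.01" f] nonneg mono global
      by (simp add: sq m_def)
    then show ?thesis
      by (simp add: sq m_def flip: power_add)
  qed
  \<comment> \<open>A pointwise substitute for Hoelder's inequality:
    \<open>4 * a * c ^ 3 \<le> a ^ 4 + 3 * c ^ 4\<close>, tight at \<open>a = c\<close>, used where
    \<open>f\<close> is 1.\<close>
  have young: "f l * a \<le> 3/4 * c * f l + 1 / (4 * c ^ 3) * a ^ 4" for l a
  proof -
    have "0 \<le> (a - c)\<^sup>2 * ((a + c)\<^sup>2 + 2 * c\<^sup>2)"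
      by simp
    also have "\<dots> = a ^ 4 + 3 * c ^ 4 - 4 * a * c ^ 3"
      by algebra
    finally have "a \<le> 3/4 * c + 1 / (4 * c ^ 3) * a ^ 4"
      using c(1) by (simp add: field_simps power_eq_if)
    moreover have "0 \<le> 1 / (4 * c ^ 3) * a ^ 4"
      using c(1) by simp
    ultimately show ?thesis
      using bool[of l] by auto
  qed
  \<comment> \<open>The tangent point is the mean degree \<open>E / m\<close> of the spectrum, where
    the bracket collapses to \<open>m\<close>.\<close>
  have "exp (- ln 3 * (E / m)) * ((1 + ln 3 * (E / m)) * expect n x (\<lambda>l. (f l)\<^sup>2) - ln 3 * energy n x f)
    \<le> expect n x (\<lambda>l. f l * noise x (1/3) f l)"
    by (rule noise_stability_ge[OF x]) (simp add: exp_minus field_simps)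
  then have "exp (- ln 3 * (E / m)) * m \<le> expect n x (\<lambda>l. f l * noise x (1/3) f l)"
    using m(1) by (simp add: sq flip: m_def E_def) (simp add: field_simps)
  also have "\<dots> \<le> expect n x (\<lambda>l. 3/4 * c * f l + 1 / (4 * c ^ 3) * noise x (1/3) f l ^ 4)"
    by (rule expect_mono[OF x]) (rule young)
  also have "\<dots> = 3/4 * c * m + 1 / (4 * c ^ 3) * expect n x (\<lambda>l. noise x (1/3) f l ^ 4)"
    by (simp only: expect_add expect_cmult m_def)
  also have "\<dots> \<le> 3/4 * c * m + 1 / (4 * c ^ 3) * (c ^ 4 * m)"
    using T4 c by (intro add_left_mono mult_left_mono) auto
  also have "\<dots> = c * m"
    using c(1) by (simp add: field_simps power_eq_if)
  finally have "exp (- ln 3 * (E / m)) \<le> c"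
    using m(1) by simp
  also have "c = exp (0.0025 * ln m)"
    using m(1) by (simp add: c_def powr_def)
  finally have "- 0.0025 * ln m \<le> ln 3 * (E / m)"
    by simp
  also have "\<dots> \<le> 2 * (E / m)"
    using ln_le_minus_one[of "3::real"] m(1) energy_nonneg[OF x, of n f]
    by (intro mult_right_mono) (auto simp: E_def)
  finally show ?thesis
    using m(1) by (simp add: field_simps flip: m_def E_def)
qed


section \<open>Russo's formula and its integration\<close>

lemma isCont_expect: "isCont (\<lambda>x. expect n x f) x"
  by (induction n arbitrary: f) (auto intro!: continuous_intros)

text \<open>Russo's formula. For a monotone Boolean function each discrete derivative is 0 or 1 and
  so equals its square, which is what the energy sums up.\<close>

lemma expect_has_derivative:
  assumes "0 < x" "x < 1"
    and "\<And>l. f l = 0 \<or> f l = 1" "\<And>l m. list_all2 (\<longrightarrow>) l m \<Longrightarrow> f l \<le> f m"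
  shows "((\<lambda>x. expect n x f) has_real_derivative energy n x f / (x * (1 - x))) (at x)"
  using assms(3,4)
proof (induction n arbitrary: f)
  case (Suc n)
  have IH: "((\<lambda>x. expect n x (\<lambda>l. f (b # l))) has_real_derivative
      energy n x (\<lambda>l. f (b # l)) / (x * (1 - x))) (at x)" for b
    using Suc.prems by (intro Suc.IH) auto
  have "(f (True # l) - f (False # l))\<^sup>2 = f (True # l) - f (False # l)" for l
    using Suc.prems(1)[of "True # l"] Suc.prems(1)[of "False # l"] Suc.prems(2)[of "False # l" "True # l"]
    by (auto simp: list.rel_refl)
  \<comment> \<open>The right-hand side has exactly the shape that the product rule produces, with
    \<open>0 - 1\<close> as the derivative of \<open>1 - x\<close>.\<close>
  then have "energy (Suc n) x f / (x * (1 - x)) =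
        1 * expect n x (\<lambda>l. f (True # l)) + energy n x (\<lambda>l. f (True # l)) / (x * (1 - x)) * x
        + ((0 - 1) * expect n x (\<lambda>l. f (False # l)) + energy n x (\<lambda>l. f (False # l)) / (x * (1 - x)) * (1 - x))"
    using assms(1,2) by (simp add: expect_diff add_divide_distrib)
  then show ?case
    unfolding expect.simps by (simp only:) (intro DERIV_add DERIV_mult DERIV_diff DERIV_ident DERIV_const IH)
qed simp

text \<open>
  The differential inequality \<open>x \<mu>' \<ge> \<mu> ln (1/\<mu>) / 800\<close> says that \<open>x powr (1/1000) * ln \<mu>\<close> is nondecreasing.
\<close>

lemma expect_powr_mono:
  assumes pq: "0 < p" "p \<le> q" "q < 1"
    and bool: "\<And>l. f l = 0 \<or> f l = 1"
    and mono: "\<And>l m. list_all2 (\<longrightarrow>) l m \<Longrightarrow> f l \<le> f m"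
    and pos: "0 < expect n p f"
    and global: "\<And>x js. p \<le> x \<Longrightarrow> x \<le> q \<Longrightarrow> expect n p f \<le> expect n x f \<Longrightarrow> length js = n \<Longrightarrow>
      expect n x (\<lambda>l. f (map2 (\<or>) js l)) \<le> expect n x f powr 0.01 * 2 ^ count_list js True"
  shows "expect n p f powr ((p / q) powr (1 / 1000)) \<le> expect n q f"
proof -
  define m where "m x = expect n x f" for x
  define E where "E x = energy n x f" for x
  have deriv: "(m has_real_derivative E x / (x * (1 - x))) (at x)" if "0 < x" "x < 1" for x
    unfolding m_def E_def using expect_has_derivative[OF that bool mono] .
  \<comment> \<open>\<open>global\<close> is assumed only where the measure is at least its value at
    \<open>p\<close>; monotonicity in the bias supplies this on the whole interval.\<close>
  have ge_p: "m p \<le> m x" if "p \<le> x" "x \<le> q" for x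
  proof (rule DERIV_nonneg_imp_nondecreasing[OF that(1)])
    fix y assume "p \<le> y" "y \<le> x"
    then have y: "0 < y" "y < 1"
      using that pq by auto
    then have "0 \<le> E y / (y * (1 - y))"
      using energy_nonneg[of y n f] by (simp add: E_def)
    then show "\<exists>d. (m has_real_derivative d) (at y) \<and> d \<ge> 0"
      using deriv[OF y] by blast
  qed
  have m_pos: "0 < m x" if "p \<le> x" "x \<le> q" for x
    using ge_p[OF that] pos by (simp add: m_def)
  have m_le: "m x \<le> 1" if "0 \<le> x" "x \<le> 1" for x
  proof -
    have "m x \<le> expect n x (\<lambda>_. 1)"
      unfolding m_def using bool by (intro expect_mono that) (metis order_refl zero_le_one)
    then show ?thesis by (simp add: expect_const)
  qed
  have "p powr (1/1000) * ln (m p) \<le> q powr (1/1000) * ln (m q)"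
  proof (rule DERIV_nonneg_imp_nondecreasing[OF pq(2)])
    fix x assume x: "p \<le> x" "x \<le> q"
    then have x01: "0 < x" "x < 1"
      using pq by auto
    define d where "d = x powr (1/1000) / (1000 * x) * ln (m x) + x powr (1/1000) * (E x / (x * (1 - x)) / m x)"
    have "((\<lambda>x. x powr (1/1000) * ln (m x)) has_real_derivative d) (at x)"
    proof -
      have "((\<lambda>x. x powr (1/1000)) has_real_derivative x powr (1/1000) / (1000 * x)) (at x)"
        using has_real_derivative_powr[OF x01(1), of "1/1000", unfolded powr_diff] x01 by simp
      from DERIV_mult[OF this DERIV_chain2[OF DERIV_ln[OF m_pos[OF x]] deriv[OF x01]]]
      show ?thesis
        unfolding d_def by (simp add: field_simps)
    qed
    moreover have "0 \<le> d"
    proof -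
      have ln: "0 \<le> - ln (m x)"
        using m_pos[OF x] m_le[of x] x01 by simp
      have "- (m x * ln (m x)) / 800 \<le> E x"
        unfolding m_def E_def
        using x01 bool mono m_pos[OF x] global[OF x] ge_p[OF x] by (intro energy_ge_of_global) (auto simp: m_def)
      then have "- ln (m x) / 800 \<le> E x / m x"
        using m_pos[OF x] by (simp add: field_simps)
      then have "- ln (m x) / 1000 \<le> E x / m x"
        using ln by simp
      also have "\<dots> \<le> E x / m x / (1 - x)"
        using x01 m_pos[OF x] energy_nonneg[of x n f] by (simp add: E_def field_simps mult_left_le)
      finally have "0 \<le> x powr (1/1000) / x * (ln (m x) / 1000 + E x / m x / (1 - x))"
        using x01 by (intro mult_nonneg_nonneg) auto
      also have "\<dots> = d"
        using x01 m_pos[OF x] unfolding d_def by (simp add: field_simps)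
      finally show ?thesis .
    qed
    ultimately show "\<exists>d. ((\<lambda>x. x powr (1/1000) * ln (m x)) has_real_derivative d) (at x) \<and> d \<ge> 0"
      by blast
  qed
  then have "(p / q) powr (1/1000) * ln (m p) \<le> ln (m q)"
    using pq by (simp add: powr_divide field_simps)
  then have "exp ((p / q) powr (1/1000) * ln (m p)) \<le> exp (ln (m q))"
    by simp
  then show ?thesis
    using m_pos[of p] m_pos[of q] pq by (simp add: powr_def flip: m_def)
qed

section \<open>Bit lists as points of the cube\<close>

text \<open>The list \<open>is\<close> fixes an order of the coordinates; the value
  \<open>False\<close> elsewhere agrees with the default in \<open>cube\<close> and
  \<open>biased\<close>.\<close>

fun point :: "nat list \<Rightarrow> bool list \<Rightarrow> nat \<Rightarrow> bool" where
  "point (i # is) (b # l) = (point is l)(i := b)"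
| "point _ _ = (\<lambda>_. False)"

lemma point_imp_mem: "point is l i \<Longrightarrow> i \<in> set is"
  by (induction "is" l rule: point.induct) (auto split: if_splits)

lemma point_in_cube: "point is l \<in> cube (set is)"
  using point_imp_mem by (auto simp: cube_def PiE_dflt_def)

lemma point_mono: "list_all2 (\<longrightarrow>) l m \<Longrightarrow> point is l \<le> point is m"
proof (induction arbitrary: "is" rule: list_all2_induct)
  case (Cons b l c m)
  then show ?case
    by (cases "is") (auto simp: le_fun_def)
qed simp

text \<open>Translates a code \<open>js\<close> into the set of coordinates that it restricts to
  1.\<close>

lemma point_map2_or:
  "length js = length is \<Longrightarrow> length l = length is \<Longrightarrow>
    point is (map2 (\<or>) js l) = override_on (point is l) (\<lambda>_. True) {i. point is js i}"
proof (induction js arbitrary: "is" l)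
  case (Cons b js)
  then show ?case
    by (cases "is"; cases l) (auto simp: override_on_def fun_eq_iff)
qed (auto simp: override_on_def)

lemma card_point:
  "distinct is \<Longrightarrow> length js = length is \<Longrightarrow> card {i. point is js i} = count_list js True"
proof (induction js arbitrary: "is")
  case (Cons b js)
  then obtain i is' where i: "is = i # is'" "distinct is'" "i \<notin> set is'" "length js = length is'"
    by (cases "is") auto
  have fin: "finite {k. point is' js k}"
    by (rule finite_subset[of _ "set is'"]) (auto dest: point_imp_mem)
  have "i \<notin> {k. point is' js k}"
    using i(3) point_imp_mem by auto
  moreover have "{k. point is (b # js) k} = (if b then insert i {k. point is' js k} else {k. point is' js k})"
    using i(1,3) point_imp_mem by auto
  ultimately show ?case
    using fin Cons.IH[OF i(2,4)] by simp
qed simp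

text \<open>By independence, the law on an enlarged index set is one Bernoulli draw combined with a
  draw on the rest, which is the recursion of \<open>expect\<close>.\<close>

lemma expectation_biased:
  assumes "0 \<le> x" "x \<le> 1" "distinct is"
  shows "measure_pmf.expectation (biased (set is) x) h = expect (length is) x (\<lambda>l. h (point is l))"
  using assms(3)
proof (induction "is" arbitrary: h)
  case Nil
  then show ?case
    by (simp add: biased_def)
next
  case (Cons i "is")
  have fin: "finite (set_pmf (biased (set is) x))"
    by (rule finite_subset[OF _ finite_PiE_dflt[of "set is" "\<lambda>_. UNIV" False]])
      (auto simp: biased_def set_Pi_pmf PiE_dflt_def)
  have "biased (set (i # is)) x
      = bernoulli_pmf x \<bind> (\<lambda>b. map_pmf (\<lambda>w. w(i := b)) (biased (set is) x))"
    using Cons.prems by (simp add: biased_def Pi_pmf_insert' map_pmf_def)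
  then have "measure_pmf.expectation (biased (set (i # is)) x) h
      = x * measure_pmf.expectation (biased (set is) x) (\<lambda>w. h (w(i := True)))
        + (1 - x) * measure_pmf.expectation (biased (set is) x) (\<lambda>w. h (w(i := False)))"
    using fin assms(1,2) by (simp only:, subst pmf_expectation_bind[where A = UNIV]) (simp_all add: UNIV_bool subset_eq)
  then show ?case
    using Cons by simp
qed

lemma mu_eq_expect:
  assumes "0 \<le> x" "x \<le> 1" "distinct is"
  shows "mu (set is) x f = expect (length is) x (\<lambda>l. of_bool (f (point is l)))"
  unfolding mu_def by (rule expectation_biased[OF assms])

text \<open>The law on the smaller cube is the marginal of the law on the full one, and overriding
  on \<open>J\<close> hides whatever was drawn there.\<close>

lemma mu_restrict_one_eq_expect:
  assumes "0 \<le> x" "x \<le> 1" "distinct is" "J \<subseteq> set is"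
  shows "mu (set is - J) x (restrict_one J f)
    = expect (length is) x (\<lambda>l. of_bool (f (override_on (point is l) (\<lambda>_. True) J)))"
proof -
  have "biased (set is - J) x = map_pmf (\<lambda>w i. if i \<in> set is - J then w i else False) (biased (set is) x)"
    unfolding biased_def by (rule Pi_pmf_subset) auto
  then have "mu (set is - J) x (restrict_one J f)
    = measure_pmf.expectation (biased (set is) x)
        (\<lambda>w. of_bool (f (override_on (\<lambda>i. if i \<in> set is - J then w i else False) (\<lambda>_. True) J)))"
    by (simp add: mu_def restrict_one_def)
  also have "\<dots> = expect (length is) x (\<lambda>l. of_bool (f (override_on (\<lambda>i. if i \<in> set is - J then point is l i else False) (\<lambda>_. True) J)))"
    by (rule expectation_biased[OF assms(1-3)])
  also have "(\<lambda>l. override_on (\<lambda>i. if i \<in> set is - J then point is l i else False) (\<lambda>_. True) J)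
      = (\<lambda>l. override_on (point is l) (\<lambda>_. True) J)"
    using point_imp_mem by (fastforce simp: override_on_def fun_eq_iff)
  finally show ?thesis
    by meson
qed


section \<open>Endpoints, the critical probability and the theorem\<close>

lemma expect_0: "expect n 0 f = f (replicate n False)"
  by (induction n arbitrary: f) simp_all

lemma expect_1: "expect n 1 f = f (replicate n True)"
  by (induction n arbitrary: f) simp_all

lemma crit_prob_le: "0 \<le> x \<Longrightarrow> x \<le> 1 \<Longrightarrow> 1/2 \<le> mu {1..n} x f \<Longrightarrow> crit_prob n f \<le> x"
  unfolding crit_prob_def by (rule cInf_lower) (auto intro!: bdd_belowI[of _ 0])

theorem theorem5p10:
  "\<exists>C::real. C > 0 \<and>
     (\<forall>(n::nat) (f :: (nat \<Rightarrow> bool) \<Rightarrow> bool) (M::real) (p::real) (q::real).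
        mono_on (cube {1..n}) f \<and> M > 0 \<and> 0 \<le> p \<and> p \<le> q \<and> q \<le> 1 \<and>
        global_in n M {p..q} f \<and>
        q \<le> crit_prob n f \<and> mu {1..n} p f \<ge> exp (- M / C) \<longrightarrow>
          mu {1..n} q f \<ge> mu {1..n} p f powr ((p / q) powr (1 / C)) \<and>
          q \<le> M powr C * p)"
proof (intro exI[of _ 1000] conjI[OF zero_less_numeral] allI impI, elim conjE)
  fix n :: nat and f :: "(nat \<Rightarrow> bool) \<Rightarrow> bool" and M p q :: real
  assume f: "mono_on (cube {1..n}) f" and M: "0 < M" and pq: "0 \<le> p" "p \<le> q" "q \<le> 1"
    and global: "global_in n M {p..q} f"
    and crit: "q \<le> crit_prob n f" and mu_p: "exp (- M / 1000) \<le> mu {1..n} p f"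
  \<comment> \<open>Keeps the simplifier from turning \<open>{1..n}\<close> into
    \<open>{Suc 0..n}\<close>.\<close>
  note One_nat_def[simp del]
  define "is" where "is = [1..<Suc n]"
  have "is": "distinct is" "length is = n" "set is = {1..n}"
    by (auto simp: is_def)
  define F :: "bool list \<Rightarrow> real" where "F l = of_bool (f (point is l))" for l
  have mu: "mu {1..n} x f = expect n x F" if "0 \<le> x" "x \<le> 1" for x
    using mu_eq_expect[OF that "is"(1), of f] by (simp add: "is" F_def[abs_def])
  have bool: "F l = 0 \<or> F l = 1" for l
    by (simp add: F_def)
  have mono: "F l \<le> F m" if "list_all2 (\<longrightarrow>) l m" for l m
  proof -
    have "f (point is l) \<le> f (point is m)"
      using point_in_cube[of "is"] point_mono[OF that] by (intro mono_onD[OF f]) (simp_all add: "is")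
    then show ?thesis
      by (auto simp: F_def)
  qed
  have F_le: "expect n x (\<lambda>l. F (h l)) \<le> 1" if "0 \<le> x" "x \<le> 1" for x h
    using expect_mono[OF that, of n "\<lambda>l. F (h l)" "\<lambda>_. 1"] by (simp add: F_def expect_const)
  have pos: "0 < expect n p F"
    using mu_p pq mu by (simp add: less_le_trans[OF exp_gt_zero])
  have global': "expect n x (\<lambda>l. F (map2 (\<or>) js l)) \<le> expect n x F powr 0.01 * 2 ^ count_list js True"
    if x: "p \<le> x" "x \<le> q" and le: "expect n p F \<le> expect n x F" and js: "length js = n" for x js
  proof -
    define J where "J = {i. point is js i}"
    have x01: "0 \<le> x" "x \<le> 1"
      using x pq by auto
    have J: "J \<subseteq> {1..n}" "card J = count_list js True"
      using point_imp_mem[of "is" js] card_point[OF "is"(1), of js] "is" js by (auto simp: J_def)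
    show ?thesis
    proof (cases "real (card J) \<le> M")
      case True
      have "expect n x (\<lambda>l. F (map2 (\<or>) js l)) = mu ({1..n} - J) x (restrict_one J f)"
        using mu_restrict_one_eq_expect[OF x01 "is"(1), of J f] J "is" js
        by (auto simp: F_def J_def point_map2_or intro!: expect_cong)
      also have "\<dots> \<le> mu {1..n} x f powr 0.01"
        using global True J(1) x by (auto simp: global_in_def)
      also have "\<dots> \<le> expect n x F powr 0.01 * 2 ^ count_list js True"
        using mult_left_mono[of 1 "2 ^ count_list js True" "expect n x F powr 0.01"]
        unfolding mu[OF x01] by simp
      finally show ?thesis .
    next
      case False
      \<comment> \<open>For \<open>card J > M\<close> the desired bound is at least 1: the exponent
        \<open>card J / 2\<close> outweighs \<open>M / 100000\<close>.\<close>
      have "1 \<le> exp (- M / 1000 * 0.01) * exp (1/2 * real (count_list js True))"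
        using False M unfolding J(2) by (simp flip: exp_add)
      also have "\<dots> \<le> expect n x F powr 0.01 * 2 ^ count_list js True"
      proof (rule mult_mono)
        have "exp (- M / 1000) powr 0.01 \<le> expect n x F powr 0.01"
          using mu_p le pq mu[of p] by (intro powr_mono2) auto
        then show "exp (- M / 1000 * 0.01) \<le> expect n x F powr 0.01"
          by (simp add: powr_def mult.commute)
        have "(1/2::real) \<le> ln 2"
          using ln2_ge_two_thirds by simp
        then have "exp (1/2 * real (count_list js True)) \<le> exp (ln 2 * real (count_list js True))"
          unfolding exp_le_cancel_iff by (rule mult_right_mono) simp
        then show "exp (1/2 * real (count_list js True)) \<le> 2 ^ count_list js True"
          by (simp add: exp_of_nat2_mult)
      qed simp_all
      finally show ?thesis
        using F_le[OF x01, of "map2 (\<or>) js"] by simp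
    qed
  qed
  show "mu {1..n} q f \<ge> mu {1..n} p f powr ((p / q) powr (1 / 1000)) \<and> q \<le> M powr 1000 * p"
  proof (cases "p = 0")
    case True
    \<comment> \<open>At bias 0 all mass lies on the all-\<open>False\<close> point, so positivity
      forces the value 1. The critical probability is then at most 0 and \<open>q\<close> collapses
      to 0.\<close>
    then have "mu {1..n} 0 f = 1"
      using pos bool[of "replicate n False"] by (simp add: mu expect_0)
    moreover from this have "q = 0"
      using crit_prob_le[of 0 n f] crit pq by simp
    ultimately show ?thesis
      using True by simp
  next
    case False
    then have p: "0 < p" "0 < q"
      using pq by auto
    \<comment> \<open>The infimum only controls biases strictly below \<open>q\<close>; left
      continuity extends the bound to \<open>q\<close> itself.\<close>
    have half: "expect n q F \<le> 1/2"
    proof (rule ccontr)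
      assume "\<not> expect n q F \<le> 1/2"
      moreover have "((\<lambda>x. expect n x F) \<longlongrightarrow> expect n q F) (at_left q)"
        using isCont_expect[of q n F] unfolding isCont_def by (rule tendsto_within_subset) simp
      ultimately have "eventually (\<lambda>x. 1/2 < expect n x F) (at_left q)"
        by (intro order_tendstoD) auto
      then obtain b where b: "b < q" "\<forall>y>b. y < q \<longrightarrow> 1/2 < expect n y F"
        unfolding eventually_at_left[OF p(2)] by auto
      obtain y where y: "max b 0 < y" "y < q"
        using dense[of "max b 0" q] b(1) p(2) by auto
      then have "crit_prob n f \<le> y"
        using b(2) pq mu[of y] by (intro crit_prob_le) auto
      then show False
        using crit y by simp
    qed
    \<comment> \<open>Russo's formula divides by \<open>1 - x\<close>. At bias 1,
      \<open>half\<close> makes \<open>F\<close> vanish at the all-\<open>True\<close> point, hence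
      everywhere by monotonicity.\<close>
    have "q \<noteq> 1"
    proof
      assume "q = 1"
      then have "F (replicate n True) = 0"
        using half bool[of "replicate n True"] by (auto simp: expect_1)
      moreover have "F l \<le> F (replicate n True)" if "length l = n" for l
        using that by (intro mono) (auto simp: list_all2_conv_all_nth)
      ultimately have "expect n p F \<le> expect n p (\<lambda>_. 0)"
        using pq by (intro expect_mono) auto
      then show False
        using pos by (simp add: expect_const)
    qed
    define t where "t = (p / q) powr (1 / 1000)"
    have main: "expect n p F powr t \<le> expect n q F"
      unfolding t_def using p pq \<open>q \<noteq> 1\<close> bool mono pos global'
      by (intro expect_powr_mono) auto
    have t: "0 < t"
      using p by (simp add: t_def)
    \<comment> \<open>Together with \<open>main\<close> and \<open>half\<close> this chain yields
      \<open>t * M \<ge> 500\<close>, hence \<open>1 \<le> t * M\<close>. The power 1000 then turns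
      \<open>t\<close> back into \<open>p / q\<close>.\<close>
    have "1 - t * M / 1000 \<le> exp (- M / 1000) powr t"
      using exp_ge_add_one_self[of "- (t * M / 1000)"] by (simp add: powr_def)
    also have "\<dots> \<le> expect n p F powr t"
      using mu_p mu[of p] pq t by (intro powr_mono2) auto
    finally have "1 \<le> t * M"
      using main half by simp
    then have "1 \<le> (t * M) powr 1000"
      by (simp add: ge_one_powr_ge_zero)
    also have "\<dots> = p / q * M powr 1000"
      using p t M by (simp add: powr_mult t_def powr_powr)
    finally have "q \<le> M powr 1000 * p"
      using p by (simp add: field_simps)
    then show ?thesis
      using main pq by (simp add: mu t_def)
  qed
qed

end
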